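(* Let $\frac pq$ be a Markov fraction and let $k\ge2$. The best approximants of a companion $\gamma_k^{\pm}\big(\frac pq\big)$ are precisely $\frac pq$ and $\gamma_{k-1}^{\pm}\big(\frac pq\big)$ (with the same sign $\pm$ throughout), i.e. $$C\Big(\gamma_k^{\pm}\Big(\frac pq\Big)\Big)=q^2\,\Big|\gamma_k^{\pm}\Big(\frac pq\Big)-\frac pq\Big|=(q\,u_{k-1})^2\,\Big|\gamma_k^{\pm}\Big(\frac pq\Big)-\gamma_{k-1}^{\pm}\Big(\frac pq\Big)\Big|$$ and $$C\Big(\gamma_k^{\pm}\Big(\frac pq\Big)\Big)<b^2\,\Big|\gamma_k^{\pm}\Big(\frac pq\Big)-\frac ab\Big|$$ for every rational number $\frac ab$ except $\frac pq$, $\gamma_{k-1}^{\pm}\big(\frac pq\big)$ and $\gamma_k^{\pm}\big(\frac pq\big)$. Moreover, $$C\Big(\gamma_k^{\pm}\Big(\frac pq\Big)\Big)=q\,\frac{u_{k-1}}{u_k}\ge\frac13,$$ where equality holds if and only if $k=2$.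
   Context: For $x\in\mathbb{R}$ the approximation constant is $C(x)=\inf_{\frac ab\in\mathbb{Q}\setminus\{x\}} b^2\,\big|x-\frac ab\big|$. A Markov triple is a triple $(q_1,q_2,q_3)$ of positive integers with $q_1^2+q_2^2+q_3^2=3q_1q_2q_3$. A triple of rational numbers $(x_1,x_2,x_3)$ is a rational Markov triple if $x_k=\frac{p_k}{q_k}$ for some Markov triple $(q_1,q_2,q_3)$ and some integers $p_1,p_2,p_3$ satisfying $p_2q_1-p_1q_2=q_3$ and $p_3q_2-p_2q_3=q_1$. (Then the fractions $\frac{p_k}{q_k}$ are automatically reduced.) A Markov fraction is a rational number that is an element of some rational Markov triple. For a Markov fraction $\frac pq$ (reduced, $q>0$), define the integer sequence $(u_k)_{k\ge 0}$ by $u_0=0$, $u_1=1$, $u_{k+1}=3q\,u_k-u_{k-1}$, and set $\gamma_k^{\pm}\big(\frac pq\big)=\frac pq\pm\frac{u_{k-1}}{q\,u_k}$ for $k\ge1$. In particular $\gamma_1^{\pm}\big(\frac pq\big)=\frac pq$. The right and left companions of $\frac pq$ are the numbers $\gamma_k^{+}\big(\frac pq\big)$ and $\gamma_k^{-}\big(\frac pq\big)$ with $k\ge2$. *)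

theory Defs
  imports Complex_Main
begin

text \<open>
  The quantity $b^2 |x - a/b|$ for the rational number $a/b$ in lowest terms with $b > 0$
  (this is what \<^const>\<open>quotient_of\<close> returns).  A representation that is not reduced has
  a larger $b$, so restricting to reduced ones does not affect the infimum below.
\<close>

definition approx_quality :: "real \<Rightarrow> rat \<Rightarrow> real" where
  "approx_quality x r = (real_of_int (snd (quotient_of r)))\<^sup>2 * \<bar>x - real_of_rat r\<bar>"

definition approx_const :: "real \<Rightarrow> real" where
  "approx_const x = (INF r\<in>{r. real_of_rat r \<noteq> x}. approx_quality x r)"

definition best_approximants :: "real \<Rightarrow> rat set" where
  "best_approximants x = {r. real_of_rat r \<noteq> x \<and> approx_quality x r = approx_const x}"

definition markov_triple :: "int \<Rightarrow> int \<Rightarrow> int \<Rightarrow> bool" where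
  "markov_triple q1 q2 q3 \<longleftrightarrow>
     q1 > 0 \<and> q2 > 0 \<and> q3 > 0 \<and> q1\<^sup>2 + q2\<^sup>2 + q3\<^sup>2 = 3 * q1 * q2 * q3"

definition rational_markov_triple :: "rat \<Rightarrow> rat \<Rightarrow> rat \<Rightarrow> bool" where
  "rational_markov_triple x1 x2 x3 \<longleftrightarrow>
     (\<exists>p1 p2 p3 q1 q2 q3. markov_triple q1 q2 q3 \<and>
        x1 = Fract p1 q1 \<and> x2 = Fract p2 q2 \<and> x3 = Fract p3 q3 \<and>
        p2 * q1 - p1 * q2 = q3 \<and> p3 * q2 - p2 * q3 = q1)"

definition markov_fraction :: "rat \<Rightarrow> bool" where
  "markov_fraction x \<longleftrightarrow> (\<exists>x1 x2 x3. rational_markov_triple x1 x2 x3 \<and> x \<in> {x1, x2, x3})"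

fun useq :: "int \<Rightarrow> nat \<Rightarrow> int" where
  "useq q 0 = 0"
| "useq q (Suc 0) = 1"
| "useq q (Suc (Suc k)) = 3 * q * useq q (Suc k) - useq q k"

text \<open>
  The number $\gamma_k^{\pm}(p/q)$, for $p/q$ reduced with $q > 0$ and $k \ge 1$.
  The sign \<open>s\<close> is to be taken from $\{1, -1\}$; the companions of $p/q$ are the values with $k \ge 2$.
\<close>

definition companion_seq :: "int \<Rightarrow> int \<Rightarrow> int \<Rightarrow> nat \<Rightarrow> rat" where
  "companion_seq s p q k =
     Fract p q + of_int s * (of_int (useq q (k - 1)) / (of_int q * of_int (useq q k)))"

end

theory Submission
  imports Defs
begin

text \<open>
  Write \<open>u\<close>, \<open>U\<close> for \<open>u\<^sub>k\<^sub>-\<^sub>1\<close>, \<open>u\<^sub>k\<close>.  For a fraction \<open>a/b\<close> with \<open>b > 0\<close> put \<open>c = s (a q - b p)\<close>.  Clearing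
  denominators, \<open>b\<^sup>2 \<bar>x - a/b\<bar>\<close> is \<open>b \<bar>D\<bar> / (q U)\<close> with \<open>D = c U - b u\<close>, so the whole theorem says that the
  product \<open>b \<bar>D\<bar>\<close> of two integers is at least \<open>q\<^sup>2 u\<close>, with equality only for the points \<open>(b, c)\<close> of
  the claimed best approximants (\<open>companion_product_bound\<close>).  What is known about \<open>(b, c)\<close> is a congruence: if \<open>(q, l, r)\<close> is the
  Markov triple behind \<open>p/q\<close>, suitably ordered, then \<open>-s p\<close> is congruent to \<open>r/l\<close> modulo \<open>q\<close>, and
  hence \<open>q\<close> divides \<open>l c - r b\<close>.  From then on \<open>p\<close> no longer occurs.

  Two facts about Markov triples \<open>(m, l, r)\<close> carry the proof.

  \<^item> Positive integers \<open>x\<close>, \<open>y\<close> with \<open>m\<close> dividing \<open>l y + r x\<close> or \<open>l y - r x\<close> satisfy \<open>3 x y \<ge> m\<close>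
    (\<open>markov_product_bound\<close>).  In terms of fractions: no fraction approximates \<open>p/q\<close> better than
    with the constant \<open>1/3\<close>.  The proof walks down the Markov tree: on either side of \<open>p/q\<close>, its
    neighbour in the rational Markov triple cuts the quadrant of the points \<open>(x, y)\<close> into two cones,
    and each cone is governed by the same statement for one of the smaller Markov numbers \<open>l\<close>, \<open>r\<close>.

  \<^item> On integer points \<open>(b, c)\<close> with \<open>m\<close> dividing \<open>l c - r b\<close>, the nonzero values of the form
    \<open>F = b\<^sup>2 + c\<^sup>2 - 3 m b c\<close> have absolute value at least \<open>m\<^sup>2\<close>.  Apart from a factor \<open>m\<close> this is Markov's
    indefinite form.  Positive values follow from the first fact, because the automorphism
    \<open>(b, c) \<mapsto> (3 m c - b, c)\<close> and its mirror image, applied repeatedly, move every point with \<open>F > 0\<close>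
    to one with \<open>b c \<le> 0\<close>, where that fact bounds the term \<open>- 3 m b c\<close>; negative values are exchanged
    with positive ones by a linear map that replaces \<open>F\<close> by \<open>- F\<close>.

  The form links \<open>b\<close> and \<open>D\<close>: since \<open>U\<^sup>2 + u\<^sup>2 - 3 q U u = 1\<close>, one has \<open>U\<^sup>2 F = b\<^sup>2 + D\<^sup>2 - t b D\<close> with
  \<open>t = 3 q U - 2 u\<close>, and \<open>t u = U\<^sup>2 - u\<^sup>2 - 1\<close>.  On the side \<open>D > 0\<close>, the bound on \<open>F\<close> gives
  \<open>b D > q\<^sup>2 u\<close> at once.  On the side \<open>D < 0\<close>, where both best approximants lie, the inequality
  \<open>b \<bar>D\<bar> \<le> q\<^sup>2 u\<close> together with \<open>F \<ge> q\<^sup>2\<close> forces \<open>b \<le> q\<close> or \<open>\<bar>D\<bar> \<le> q\<close>.  These two cases are exchanged by a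
  symmetry swapping \<open>b\<close> and \<open>\<bar>D\<bar>\<close>, and in each of them \<open>markov_product_bound\<close> leaves
  a single point.
\<close>

section \<open>Markov triples\<close>

lemma markov_triple_swap12: "markov_triple m l r \<Longrightarrow> markov_triple l m r"
  and markov_triple_swap23: "markov_triple m l r \<Longrightarrow> markov_triple m r l"
  by (auto simp: markov_triple_def algebra_simps)

lemma markov_triple_vieta:
  assumes "markov_triple m l r"
  shows "markov_triple m l (3 * m * l - r)"
proof -
  have pos: "m > 0" "l > 0" "r > 0" and eq: "m\<^sup>2 + l\<^sup>2 + r\<^sup>2 = 3 * m * l * r"
    using assms by (auto simp: markov_triple_def)
  have "r * (3 * m * l - r) = m\<^sup>2 + l\<^sup>2"
    using eq by (simp add: algebra_simps power2_eq_square)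
  then have "r * (3 * m * l - r) > 0"
    using pos by (simp add: add_pos_pos)
  then have "3 * m * l - r > 0"
    using pos by (simp add: zero_less_mult_iff)
  moreover have "m\<^sup>2 + l\<^sup>2 + (3 * m * l - r)\<^sup>2 = 3 * m * l * (3 * m * l - r)"
    using eq by (simp add: algebra_simps power2_eq_square)
  ultimately show ?thesis
    using pos by (simp add: markov_triple_def)
qed

text \<open>
  The number \<open>3 m l - r\<close> is the second root, besides \<open>r\<close>, of the quadratic equation that \<open>m\<close> and \<open>l\<close>
  impose.  At the larger of \<open>m\<close> and \<open>l\<close> this quadratic is not positive, so that number lies between
  the two roots.  The induction proofs below descend by this step.
\<close>

lemma markov_triple_vieta_less:
  assumes "markov_triple m l r" and "m \<le> r" and "l \<le> r" and "r > 1"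
  shows "3 * m * l - r < r"
proof -
  have *: "3 * a * b - r < r"
    if pos: "a > 0" "b > 0" "a \<le> b" "b \<le> r" and eq: "a\<^sup>2 + b\<^sup>2 + r\<^sup>2 = 3 * a * b * r"
    for a b :: int
  proof -
    define r' where "r' = 3 * a * b - r"
    have prod: "(b - r) * (b - r') = 2 * b\<^sup>2 + a\<^sup>2 - 3 * a * b\<^sup>2"
      using eq by (simp add: r'_def algebra_simps power2_eq_square)
    have a2: "a\<^sup>2 \<le> b\<^sup>2"
      using pos by simp
    have "b\<^sup>2 * 1 \<le> b\<^sup>2 * a"
      using pos by (intro mult_left_mono) auto
    then have le: "(b - r) * (b - r') \<le> 0"
      using prod a2 by (simp add: algebra_simps)
    show ?thesis
    proof (cases "b < r")
      case True
      then have "b - r' \<ge> 0"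
        using le by (simp add: mult_le_0_iff)
      then show ?thesis
        using True by (simp add: r'_def)
    next
      case False
      then have b: "b = r"
        using pos by simp
      then have eq': "3 * a * b\<^sup>2 = 2 * b\<^sup>2 + a\<^sup>2"
        using prod by simp
      have "a < 2"
      proof (rule ccontr)
        assume "\<not> a < 2"
        then have "b\<^sup>2 * 2 \<le> b\<^sup>2 * a"
          by (intro mult_left_mono) auto
        moreover have "b\<^sup>2 > 0"
          using pos by simp
        ultimately show False
          using eq' a2 by (simp add: algebra_simps)
      qed
      then have "a = 1"
        using pos by simp
      then have "b\<^sup>2 = 1"
        using eq' by simp
      then show ?thesis
        using b \<open>r > 1\<close> by (simp add: power2_eq_1_iff)
    qed
  qed
  show ?thesis
  proof (cases "m \<le> l")
    case True
    then show ?thesis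
      using * [of m l] assms by (simp add: markov_triple_def)
  next
    case False
    then show ?thesis
      using * [of l m] assms by (simp add: markov_triple_def algebra_simps)
  qed
qed

lemma markov_triple_coprime:
  "markov_triple m l r \<Longrightarrow> coprime m l"
proof (induction "nat (m + l + r)" arbitrary: m l r rule: less_induct)
  case less
  note T = less.prems
  have pos: "m > 0" "l > 0" "r > 0"
    using T by (auto simp: markov_triple_def)
  consider "m = 1 \<or> l = 1" | "m \<le> r" "l \<le> r" "r > 1" | "m \<le> l" "r \<le> l" "l > 1"
    | "l \<le> m" "r \<le> m" "m > 1"
    using pos by linarith
  then show ?case
  proof cases
    case 1
    then show ?thesis
      by auto
  next
    case 2
    have "markov_triple m l (3 * m * l - r)" "3 * m * l - r < r"
      using markov_triple_vieta[OF T] markov_triple_vieta_less[OF T] 2 by simp_all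
    then show ?thesis
      using less.hyps[of m l "3 * m * l - r"] pos by (simp add: markov_triple_def)
  next
    case 3
    have S: "markov_triple m r l"
      using T by (rule markov_triple_swap23)
    have T': "markov_triple m r (3 * m * r - l)" "3 * m * r - l < l"
      using markov_triple_vieta[OF S] markov_triple_vieta_less[OF S] 3 by simp_all
    then have *: "coprime m (3 * m * r - l)"
      using less.hyps[of m "3 * m * r - l" r] pos markov_triple_swap23[OF T'(1)]
      by (simp add: markov_triple_def)
    show ?thesis
    proof (rule coprimeI)
      fix d assume "d dvd m" "d dvd l"
      then have "d dvd 3 * m * r - l" "d dvd m"
        by simp_all
      then show "is_unit d"
        using * coprime_common_divisor by blast
    qed
  next
    case 4
    have S: "markov_triple l r m"
      by (rule markov_triple_swap23[OF markov_triple_swap12[OF T]])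
    have T': "markov_triple l r (3 * l * r - m)" "3 * l * r - m < m"
      using markov_triple_vieta[OF S] markov_triple_vieta_less[OF S] 4 by simp_all
    then have *: "coprime (3 * l * r - m) l"
      using less.hyps[of "3 * l * r - m" l r] pos
        markov_triple_swap12[OF markov_triple_swap23[OF T'(1)]]
      by (simp add: markov_triple_def)
    show ?thesis
    proof (rule coprimeI)
      fix d assume "d dvd m" "d dvd l"
      then have "d dvd 3 * l * r - m" "d dvd l"
        by simp_all
      then show "is_unit d"
        using * coprime_common_divisor by blast
    qed
  qed
qed

lemma markov_triple_dvd_sum_squares:
  assumes "markov_triple m l r"
  shows "m dvd l\<^sup>2 + r\<^sup>2"
proof -
  have "l\<^sup>2 + r\<^sup>2 = m * (3 * l * r - m)"
    using assms by (simp add: markov_triple_def algebra_simps power2_eq_square)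
  then show ?thesis
    by simp
qed

text \<open>
  Since \<open>l\<^sup>2 + r\<^sup>2\<close> vanishes modulo \<open>m\<close>, the quotient \<open>r/l\<close> is a square root of \<open>-1\<close> modulo \<open>m\<close>.  Hence
  interchanging \<open>x\<close> and \<open>y\<close> in the congruence \<open>l y = r x\<close> changes its sign.
\<close>

lemma markov_dvd_swap_minus:
  assumes T: "markov_triple m l r" and d: "m dvd l * y - r * x"
  shows "m dvd l * x + r * y"
proof -
  have "l * (l * x + r * y) = (l\<^sup>2 + r\<^sup>2) * x + r * (l * y - r * x)"
    by (simp add: algebra_simps power2_eq_square)
  then have "m dvd l * (l * x + r * y)"
    using markov_triple_dvd_sum_squares[OF T] d by simp
  then show ?thesis
    using markov_triple_coprime[OF T] by (simp add: coprime_dvd_mult_right_iff)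
qed

lemma markov_dvd_swap_plus:
  assumes T: "markov_triple m l r" and d: "m dvd l * y + r * x"
  shows "m dvd l * x - r * y"
proof -
  have "m dvd l * (- x) + r * y"
    using d by (intro markov_dvd_swap_minus[OF T]) simp
  moreover have "l * (- x) + r * y = - (l * x - r * y)"
    by simp
  ultimately show ?thesis
    by (simp only: dvd_minus_iff)
qed

section \<open>How well Markov fractions can be approximated\<close>

text \<open>
  If \<open>m\<close> is not the largest entry, the triple is replaced by a smaller one with the same \<open>m\<close>; modulo
  \<open>m\<close> the new entry is the negative of the old one.  If \<open>m\<close> is the largest entry, the point
  \<open>(x, y) = (r, l)\<close> satisfies the congruence, and \<open>3 l r \<ge> m\<close> by the Markov equation.  A point on the
  ray through it is an integer multiple.  A point off that ray lies on the side of \<open>r\<close> or of \<open>l\<close>: on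
  the side with \<open>r y > l x\<close>, say, put \<open>n = (r y - l x) / m\<close>.  Then \<open>(x, n)\<close> satisfies the congruence that
  belongs to \<open>r\<close> in place of \<open>m\<close>, and \<open>r y \<ge> m n\<close> turns the bound \<open>3 x n \<ge> r\<close> into \<open>3 x y \<ge> m\<close>.
\<close>

lemma markov_product_bound_plus:
  "markov_triple m l r \<Longrightarrow> x > 0 \<Longrightarrow> y > 0 \<Longrightarrow> m dvd l * y + r * x \<Longrightarrow> m \<le> 3 * x * y"
proof (induction "nat (m + l + r)" arbitrary: m l r x y rule: less_induct)
  case less
  note T = less.prems(1) and xy = less.prems(2,3) and d = less.prems(4)
  have pos: "m > 0" "l > 0" "r > 0"
    using T by (auto simp: markov_triple_def)
  consider "m = 1" | "m \<le> r" "l \<le> r" "r > 1" | "m \<le> l" "r \<le> l" "l > 1"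
    | "l < m" "r < m" "m > 1"
    using pos by linarith
  then show ?case
  proof cases
    case 1
    have "x * y > 0"
      using xy by simp
    then show ?thesis
      using 1 by (simp add: mult.assoc)
  next
    case 2
    define r' where "r' = 3 * m * l - r"
    have T': "markov_triple m l r'" and less': "r' < r"
      using markov_triple_vieta[OF T] markov_triple_vieta_less[OF T] 2
      by (simp_all add: r'_def)
    have "l * y - r' * x = (l * y + r * x) - m * (3 * l * x)"
      by (simp add: r'_def algebra_simps)
    then have "m dvd l * x + r' * y"
      using d by (intro markov_dvd_swap_minus[OF T']) (metis dvd_diff dvd_triv_left)
    then have "m \<le> 3 * y * x"
      using less.hyps[of m l r' y x] T' less' pos xy by (simp add: markov_triple_def)
    then show ?thesis
      by (simp add: algebra_simps)
  next
    case 3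
    define l' where "l' = 3 * m * r - l"
    have S: "markov_triple m r l"
      using T by (rule markov_triple_swap23)
    have T': "markov_triple m r l'" and less': "l' < l"
      using markov_triple_vieta[OF S] markov_triple_vieta_less[OF S] 3
      by (simp_all add: l'_def)
    have "r * x - l' * y = (l * y + r * x) - m * (3 * r * y)"
      by (simp add: l'_def algebra_simps)
    then have "m dvd r * y + l' * x"
      using d by (intro markov_dvd_swap_minus[OF T']) (metis dvd_diff dvd_triv_left)
    then have "m \<le> 3 * x * y"
      using less.hyps[of m r l' x y] T' less' pos xy by (simp add: markov_triple_def)
    then show ?thesis .
  next
    case 4
    define m' where "m' = 3 * l * r - m"
    have S: "markov_triple l r m"
      by (rule markov_triple_swap23[OF markov_triple_swap12[OF T]])
    have T': "markov_triple l r m'" and less': "m' < m"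
      using markov_triple_vieta[OF S] markov_triple_vieta_less[OF S] 4
      by (simp_all add: m'_def)
    have m'_pos: "m' > 0"
      using T' by (simp add: markov_triple_def)
    have "m dvd l * x - r * y"
      using T d by (rule markov_dvd_swap_plus)
    then obtain z where z: "l * x - r * y = m * z"
      by (rule dvdE)
    consider "z = 0" | "z > 0" | "z < 0"
      by linarith
    then show ?thesis
    proof cases
      case 1
      have eq: "l * x = r * y"
        using z 1 by simp
      have cop: "coprime l r"
        by (rule markov_triple_coprime[OF S])
      have "r dvd x" "l dvd y"
        using cop eq by (metis coprime_commute coprime_dvd_mult_right_iff dvd_triv_left)+
      then have "r \<le> x" "l \<le> y"
        using xy by (auto intro: zdvd_imp_le)
      then have "r * l \<le> x * y"
        using pos by (intro mult_mono) auto
      moreover have "m \<le> 3 * l * r"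
        using m'_pos by (simp add: m'_def)
      ultimately show ?thesis
        by (simp add: algebra_simps)
    next
      case 2
      have "r * y - m' * z = l * x - 3 * l * r * z"
        using z by (simp add: m'_def algebra_simps)
      also have "\<dots> = l * (x - 3 * r * z)"
        by (simp add: algebra_simps)
      finally have "l dvd r * z + m' * y"
        by (intro markov_dvd_swap_minus[OF T']) simp
      then have "l \<le> 3 * y * z"
        using less.hyps[of l r m' y z] T' less' pos xy m'_pos 2 by simp
      then have "m * l \<le> m * (3 * y * z)"
        using pos by simp
      also have "\<dots> = 3 * y * (m * z)"
        by (simp add: algebra_simps)
      also have "\<dots> \<le> 3 * y * (l * x)"
        using z[symmetric] xy pos by (intro mult_left_mono) auto
      finally have "m * l \<le> (3 * x * y) * l"
        by (simp add: algebra_simps)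
      then show ?thesis
        using pos by simp
    next
      case 3
      define n where "n = - z"
      have n: "r * y - l * x = m * n" "n > 0"
        using z 3 by (auto simp: n_def)
      have T'': "markov_triple r l m'"
        using T' by (rule markov_triple_swap12)
      have "l * x - m' * n = r * y - 3 * l * r * n"
        using n by (simp add: m'_def algebra_simps)
      also have "\<dots> = r * (y - 3 * l * n)"
        by (simp add: algebra_simps)
      finally have "r dvd l * n + m' * x"
        by (intro markov_dvd_swap_minus[OF T'']) simp
      then have "r \<le> 3 * x * n"
        using less.hyps[of r l m' x n] T'' less' pos xy m'_pos n by simp
      then have "m * r \<le> m * (3 * x * n)"
        using pos by simp
      also have "\<dots> = 3 * x * (m * n)"
        by (simp add: algebra_simps)
      also have "\<dots> \<le> 3 * x * (r * y)"
        using n(1)[symmetric] xy pos by (intro mult_left_mono) auto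
      finally have "m * r \<le> (3 * x * y) * r"
        by (simp add: algebra_simps)
      then show ?thesis
        using pos by simp
    qed
  qed
qed

lemma markov_product_bound:
  assumes T: "markov_triple m l r" and "x > 0" "y > 0"
    and d: "m dvd l * y - r * x \<or> m dvd l * y + r * x"
  shows "m \<le> 3 * x * y"
proof (cases "m dvd l * y + r * x")
  case True
  with assms show ?thesis
    by (intro markov_product_bound_plus)
next
  case False
  then have "m dvd l * x + r * y"
    using d by (auto intro: markov_dvd_swap_minus[OF T])
  then have "m \<le> 3 * y * x"
    using assms by (intro markov_product_bound_plus)
  then show ?thesis
    by (simp add: algebra_simps)
qed

section \<open>The minimum of the Markov form\<close>

text \<open>
  For \<open>b c < 0\<close> the mixed term \<open>3 m \<bar>b c\<bar>\<close> alone is at least \<open>m\<^sup>2\<close>.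
\<close>

lemma markov_form_positive_values_nonpos:
  fixes b c :: int
  assumes T: "markov_triple m l r" and d: "m dvd l * c - r * b \<or> m dvd l * c + r * b"
    and pos: "b\<^sup>2 + c\<^sup>2 - 3 * m * b * c > 0" and bc: "b * c \<le> 0"
  shows "m\<^sup>2 \<le> b\<^sup>2 + c\<^sup>2 - 3 * m * b * c"
proof -
  have mpos: "m > 0"
    using T by (simp add: markov_triple_def)
  have cop: "coprime m l" "coprime m r"
    using markov_triple_coprime[OF T] markov_triple_coprime[OF markov_triple_swap23[OF T]]
    by simp_all
  have square_ge: "m\<^sup>2 \<le> z\<^sup>2" if "m dvd z" "z \<noteq> 0" for z :: int
    using that mpos by (metis abs_le_square_iff dvd_imp_le_int abs_of_pos)
  consider "b = 0" | "c = 0" | "b \<noteq> 0" "c \<noteq> 0" by blast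
  then show ?thesis
  proof cases
    case 1
    then show ?thesis
      using d cop pos square_ge[of c] by (auto simp: coprime_dvd_mult_right_iff)
  next
    case 2
    then show ?thesis
      using d cop pos square_ge[of b] by (auto simp: coprime_dvd_mult_right_iff)
  next
    case 3
    have "m \<le> 3 * \<bar>b\<bar> * \<bar>c\<bar>"
    proof (rule markov_product_bound[OF T])
      have "\<bar>b\<bar> = b \<and> \<bar>c\<bar> = - c \<or> \<bar>b\<bar> = - b \<and> \<bar>c\<bar> = c"
        using bc 3 by (auto simp: mult_le_0_iff)
      moreover have "m dvd - (l * c) - r * b \<longleftrightarrow> m dvd l * c + r * b"
        by (metis dvd_minus_iff minus_add_distrib uminus_add_conv_diff add.commute)
      moreover have "m dvd - (l * c) + r * b \<longleftrightarrow> m dvd l * c - r * b"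
        by (metis dvd_minus_iff minus_diff_eq uminus_add_conv_diff)
      ultimately show "m dvd l * \<bar>c\<bar> - r * \<bar>b\<bar> \<or> m dvd l * \<bar>c\<bar> + r * \<bar>b\<bar>"
        using d by auto
    qed (use 3 in auto)
    then have "m * m \<le> m * (3 * \<bar>b\<bar> * \<bar>c\<bar>)"
      using mpos by simp
    also have "\<dots> = 3 * m * \<bar>b * c\<bar>"
      by (simp add: abs_mult)
    also have "\<dots> = - (3 * m * b * c)"
      using bc by simp
    finally have "m * m \<le> - (3 * m * b * c)" .
    moreover have "b\<^sup>2 \<ge> 0" "c\<^sup>2 \<ge> 0"
      by simp_all
    ultimately show ?thesis
      unfolding power2_eq_square[of m] by linarith
  qed
qed

text \<open>
  Vieta jumping: for fixed \<open>c\<close> the value of the form determines a quadratic equation for \<open>b\<close>, whose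
  other root is \<open>3 m c - b\<close>.  Positivity of the form makes the jump decrease the coordinate of larger absolute
  value, until \<open>b c \<le> 0\<close>.  Each jump changes the sign in the congruence, which is why both signs
  are admitted.
\<close>

lemma markov_form_positive_values:
  fixes b c :: int
  assumes T: "markov_triple m l r"
  shows "m dvd l * c - r * b \<or> m dvd l * c + r * b \<Longrightarrow> b\<^sup>2 + c\<^sup>2 - 3 * m * b * c > 0
    \<Longrightarrow> m\<^sup>2 \<le> b\<^sup>2 + c\<^sup>2 - 3 * m * b * c"
proof (induction "nat (\<bar>b\<bar> + \<bar>c\<bar>)" arbitrary: b c rule: less_induct)
  case less
  have step: "m\<^sup>2 \<le> y\<^sup>2 + z\<^sup>2 - 3 * m * y * z"
    if le: "\<bar>z\<bar> \<le> \<bar>y\<bar>" and size: "nat (\<bar>y\<bar> + \<bar>z\<bar>) = nat (\<bar>b\<bar> + \<bar>c\<bar>)"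
      and d: "m dvd l * z - r * y \<or> m dvd l * z + r * y"
      and pos: "y\<^sup>2 + z\<^sup>2 - 3 * m * y * z > 0" for y z
  proof (cases "y * z \<le> 0")
    case True
    then show ?thesis
      using T d pos by (intro markov_form_positive_values_nonpos)
  next
    case yz: False
    define y' where "y' = 3 * m * z - y"
    have form: "y'\<^sup>2 + z\<^sup>2 - 3 * m * y' * z = y\<^sup>2 + z\<^sup>2 - 3 * m * y * z"
      by (simp add: y'_def algebra_simps power2_eq_square)
    have "l * z - r * y' = (l * z + r * y) - m * (3 * r * z)"
         "l * z + r * y' = (l * z - r * y) + m * (3 * r * z)"
      by (auto simp: y'_def algebra_simps)
    then have d': "m dvd l * z - r * y' \<or> m dvd l * z + r * y'"
      using d by (metis dvd_add dvd_diff dvd_triv_left)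
    have pos': "y'\<^sup>2 + z\<^sup>2 - 3 * m * y' * z > 0"
      using form pos by simp
    have "m\<^sup>2 \<le> y'\<^sup>2 + z\<^sup>2 - 3 * m * y' * z"
    proof (cases "y' * z \<le> 0")
      case True
      then show ?thesis
        using T d' pos' by (intro markov_form_positive_values_nonpos)
    next
      case False
      have "y * y' < z\<^sup>2"
        using pos by (simp add: y'_def algebra_simps power2_eq_square)
      also have "z\<^sup>2 \<le> y\<^sup>2"
        using le by (simp add: abs_le_square_iff)
      finally have "y * y' < y * y"
        by (simp add: power2_eq_square)
      then have "\<bar>y'\<bar> < \<bar>y\<bar>"
        using False yz
        by (auto simp: mult_less_cancel_left mult_le_0_iff not_le zero_less_mult_iff)
      then show ?thesis
        using d' pos' size by (intro less.hyps) linarith+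
    qed
    then show ?thesis
      using form by simp
  qed
  show ?case
  proof (cases "\<bar>c\<bar> \<le> \<bar>b\<bar>")
    case True
    then show ?thesis
      using less.prems by (intro step) auto
  next
    case False
    have "m dvd l * b - r * c \<or> m dvd l * b + r * c"
      using less.prems(1) markov_dvd_swap_minus[OF T] markov_dvd_swap_plus[OF T] by blast
    then have "m\<^sup>2 \<le> c\<^sup>2 + b\<^sup>2 - 3 * m * c * b"
      using False less.prems(2) by (intro step) (auto simp: algebra_simps)
    then show ?thesis
      by (simp add: algebra_simps)
  qed
qed

text \<open>
  The congruence says that \<open>f = (r b - l c) / m\<close> and \<open>g = ((3 m r - l) b - r c) / m\<close> are integers.  The map
  from \<open>(b, c)\<close> to \<open>(f, g)\<close> preserves the congruence and replaces the value of the form by its negative;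
  it exists because \<open>(r, 3 m r - l)\<close> and \<open>(l, r)\<close> are points of value \<open>- m\<^sup>2\<close>.
\<close>

lemma markov_form_negative_values:
  fixes b c :: int
  assumes T: "markov_triple m l r" and d: "m dvd l * c - r * b"
    and neg: "b\<^sup>2 + c\<^sup>2 - 3 * m * b * c < 0"
  shows "b\<^sup>2 + c\<^sup>2 - 3 * m * b * c \<le> - m\<^sup>2"
proof -
  have mpos: "m > 0" and eq: "m\<^sup>2 + l\<^sup>2 + r\<^sup>2 = 3 * m * l * r"
    using T by (auto simp: markov_triple_def)
  obtain f where f: "r * b - l * c = m * f"
    using d by (metis dvd_minus_iff minus_diff_eq dvdE)
  obtain h where h: "l * b + r * c = m * h"
    using markov_dvd_swap_minus[OF T d] by (rule dvdE)
  define g where "g = 3 * r * b - h"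
  have g: "m * g = (3 * m * r - l) * b - r * c"
    using h by (simp add: g_def algebra_simps)
  have "m * (l * g - r * f) = l * (m * g) - r * (m * f)"
    by (simp add: algebra_simps)
  also have "\<dots> = (3 * m * l * r - l\<^sup>2 - r\<^sup>2) * b"
    unfolding g f[symmetric] by (simp add: algebra_simps power2_eq_square)
  also have "\<dots> = m * (m * b)"
    using eq[symmetric] by (simp add: power2_eq_square)
  finally have d': "m dvd l * g - r * f"
    using mpos by simp
  have "m\<^sup>2 * (f\<^sup>2 + g\<^sup>2 - 3 * m * f * g) = (m * f)\<^sup>2 + (m * g)\<^sup>2 - 3 * m * (m * f) * (m * g)"
    by (simp add: algebra_simps power2_eq_square)
  also have "\<dots> = (l\<^sup>2 + r\<^sup>2 - 3 * m * l * r) * (b\<^sup>2 + c\<^sup>2 - 3 * m * b * c)"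
    unfolding g f[symmetric] by (simp add: algebra_simps power2_eq_square)
  also have "l\<^sup>2 + r\<^sup>2 - 3 * m * l * r = m\<^sup>2 * (- 1)"
    using eq by simp
  finally have "m\<^sup>2 * (f\<^sup>2 + g\<^sup>2 - 3 * m * f * g + (b\<^sup>2 + c\<^sup>2 - 3 * m * b * c)) = 0"
    by (simp add: distrib_left)
  then have form: "f\<^sup>2 + g\<^sup>2 - 3 * m * f * g = - (b\<^sup>2 + c\<^sup>2 - 3 * m * b * c)"
    using mpos by simp
  have "m\<^sup>2 \<le> f\<^sup>2 + g\<^sup>2 - 3 * m * f * g"
    using d' form neg by (intro markov_form_positive_values[OF T]) auto
  then show ?thesis
    using form by simp
qed

section \<open>The sequence in the denominators of the companions\<close>

lemma useq_growth:
  assumes "q > 0"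
  shows "0 \<le> useq q k \<and> 2 * q * useq q k \<le> useq q (Suc k) \<and> 0 < useq q (Suc k)"
proof (induction k)
  case 0
  then show ?case
    by simp
next
  case (Suc k)
  let ?u = "useq q (Suc k)"
  have u: "useq q k \<ge> 0" "2 * q * useq q k \<le> ?u" "?u > 0"
    using Suc by auto
  have "1 * useq q k \<le> q * useq q k" "1 * ?u \<le> q * ?u"
    using u assms by (intro mult_right_mono; linarith)+
  then have "2 * q * ?u \<le> 3 * q * ?u - useq q k"
    using u(1,2) unfolding mult.assoc by linarith
  moreover have "0 < 2 * q * ?u"
    using u assms by simp
  ultimately show ?case
    using u by simp
qed

lemma useq_invariant:
  "(useq q (Suc k))\<^sup>2 + (useq q k)\<^sup>2 - 3 * q * useq q (Suc k) * useq q k = 1"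
proof (induction k)
  case (Suc k)
  then show ?case
    by (simp add: algebra_simps power2_eq_square)
qed simp

section \<open>The minimum for a companion\<close>

text \<open>
  This treats the points with denominator at most \<open>q\<close> on the side of the companion that contains
  \<open>p/q\<close>; there \<open>p/q\<close> itself is the point with \<open>c = 0\<close>.  A positive \<open>c\<close> would contradict \<open>b \<le> q\<close>,
  as \<open>U\<close> exceeds \<open>q u\<close>.  A negative \<open>c\<close> means that \<open>p/q\<close> lies strictly between the companion and the
  fraction, and then the bound for approximations of \<open>p/q\<close> applies.
\<close>

lemma small_denominator_bound:
  fixes b c u U w :: int
  assumes T: "markov_triple q l r" and d: "q dvd l * c - r * b \<or> q dvd l * c + r * b"
    and b: "0 < b" "b \<le> q" and D: "b * u - c * U > 0"
    and U: "U = 3 * q * u - w" "2 * q * u \<le> U" and w: "0 \<le> w" "2 * q * w \<le> u" and u: "u > 0"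
  shows "c = 0 \<or> q\<^sup>2 * u < b * (b * u - c * U)"
proof -
  have q: "q > 0"
    using T by (simp add: markov_triple_def)
  consider "c = 0" | "c > 0" | "c < 0"
    by linarith
  then show ?thesis
  proof cases
    case 1
    then show ?thesis
      by simp
  next
    case 2
    have qu: "0 < q * u"
      using q u by simp
    then have "U > 0"
      using U(2) by (simp add: mult.assoc)
    then have "b * u \<le> q * u" "1 * U \<le> c * U"
      using 2 b u by (auto intro!: mult_right_mono)
    then have False
      using D U(2) qu by (simp add: mult.assoc)
    then show ?thesis ..
  next
    case 3
    define y where "y = - c"
    have "q \<le> 3 * b * y"
    proof (rule markov_product_bound[OF T])
      show "q dvd l * y - r * b \<or> q dvd l * y + r * b"
      proof -
        have "l * y - r * b = - (l * c + r * b)" "l * y + r * b = - (l * c - r * b)"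
          by (auto simp: y_def)
        then show ?thesis
          using d by (metis dvd_minus_iff)
      qed
    qed (use b 3 in \<open>auto simp: y_def\<close>)
    moreover have "U \<ge> 0"
      using U(2) q u by (smt (verit) mult_pos_pos)
    ultimately have 1: "q * U \<le> 3 * b * y * U"
      by (rule mult_right_mono)
    (* The main terms q * U and 3 * q^2 * u differ only by q * w, which b^2 * u outweighs. *)
    have 2: "1 * u \<le> b\<^sup>2 * u"
      using b u by (intro mult_right_mono) auto
    have "0 \<le> q * w"
      using q w by simp
    then have 3: "q * w < 3 * u"
      using w(2) u unfolding mult.assoc by linarith
    have "3 * (b * (b * u - c * U)) = 3 * (b\<^sup>2 * u) + 3 * b * y * U"
      by (simp add: y_def algebra_simps power2_eq_square)
    also have "\<dots> \<ge> 3 * u + q * U"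
      using 1 2 by linarith
    also have "3 * u + q * U = 3 * (q\<^sup>2 * u) + (3 * u - q * w)"
      by (simp add: U(1) algebra_simps power2_eq_square)
    finally show ?thesis
      using 3 by linarith
  qed
qed

text \<open>
  The numbers \<open>w\<close>, \<open>u\<close>, \<open>U\<close> stand for three consecutive terms of the sequence.  The two exceptional
  points are \<open>p/q\<close> and the preceding companion; for \<open>w = 0\<close> they coincide.
\<close>

lemma companion_product_bound:
  fixes b c u U w :: int
  assumes T: "markov_triple q l r" and d: "q dvd l * c - r * b" and b: "0 < b"
    and U: "U = 3 * q * u - w" "2 * q * u \<le> U" and w: "0 \<le> w" "2 * q * w \<le> u" and u: "u > 0"
    and inv: "u\<^sup>2 + w\<^sup>2 - 3 * q * u * w = 1"
    and nz: "c * U - b * u \<noteq> 0"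
  shows "q\<^sup>2 * u < b * \<bar>c * U - b * u\<bar> \<or>
    q\<^sup>2 * u = b * \<bar>c * U - b * u\<bar> \<and> (b = q \<and> c = 0 \<or> b = q * u \<and> c = q * w)"
proof -
  have q: "q > 0"
    using T by (simp add: markov_triple_def)
  have Uu: "U\<^sup>2 + u\<^sup>2 - 3 * q * U * u = 1"
    using inv by (simp add: U(1) algebra_simps power2_eq_square)
  have Upos: "U > 0"
    using U(2) q u by (smt (verit) mult_pos_pos)
  define D where "D = c * U - b * u"
  define F where "F = b\<^sup>2 + c\<^sup>2 - 3 * q * b * c"
  define t where "t = 3 * q * U - 2 * u"
  have form: "U\<^sup>2 * F = b\<^sup>2 + D\<^sup>2 - t * (b * D)"
  proof -
    have "b\<^sup>2 + D\<^sup>2 - t * (b * D) - U\<^sup>2 * F = b\<^sup>2 * (1 - (U\<^sup>2 + u\<^sup>2 - 3 * q * U * u))"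
      by (simp add: D_def t_def F_def algebra_simps power2_eq_square)
    then show ?thesis
      using Uu by simp
  qed
  have Fpos: "q\<^sup>2 \<le> F" if "F > 0"
    using markov_form_positive_values[OF T, of c b] d that by (simp add: F_def)
  have U2: "t * u = U\<^sup>2 - (1 + u\<^sup>2)"
    using Uu by (simp add: t_def algebra_simps power2_eq_square)
  have tq2u: "t * (q\<^sup>2 * u) = q\<^sup>2 * U\<^sup>2 - q\<^sup>2 * (1 + u\<^sup>2)"
    unfolding mult.left_commute[of t "q\<^sup>2"] U2 by (rule right_diff_distrib)
  have q2u: "1 \<le> q\<^sup>2 * u"
    using q u by (simp add: int_one_le_iff_zero_less)
  have t_ge: "4 * (q\<^sup>2 * u) \<le> t"
  proof -
    have "q * (2 * q * u) \<le> q * U"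
      using U(2) q by simp
    then have "2 * (q\<^sup>2 * u) \<le> q * U"
      by (simp add: power2_eq_square algebra_simps)
    moreover have "1 * u \<le> q\<^sup>2 * u"
      using q u by (intro mult_right_mono) auto
    ultimately show ?thesis
      unfolding t_def mult.assoc by linarith
  qed
  consider "D > 0" "F \<ge> 0" | "D > 0" "F < 0" | "D < 0"
    using nz by (force simp: D_def)
  then show ?thesis
  proof cases
    case 1
    (* Here b * D is a positive integer, and form yields (b * D) * (t - b * D) <= 1:
       the value b * D cannot lie well below t. *)
    have G: "b * D \<ge> 1"
      using b 1 by (simp add: int_one_le_iff_zero_less)
    have "0 \<le> (b\<^sup>2 - 1) * (D\<^sup>2 - 1)"
      using b 1 by (intro mult_nonneg_nonneg) (auto simp: one_le_power int_one_le_iff_zero_less)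
    then have "b\<^sup>2 + D\<^sup>2 \<le> (b * D) * (b * D) + 1"
      by (simp add: algebra_simps power2_eq_square)
    moreover have "0 \<le> U\<^sup>2 * F"
      using 1 by simp
    ultimately have *: "(b * D) * (t - b * D) \<le> 1"
      using form by (simp add: algebra_simps)
    have "q\<^sup>2 * u < b * D"
    proof (rule ccontr)
      assume "\<not> ?thesis"
      then have gap: "t - b * D \<ge> 3 * (q\<^sup>2 * u)"
        using t_ge by linarith
      then have "1 * (t - b * D) \<le> (b * D) * (t - b * D)"
        using G q2u by (intro mult_right_mono) auto
      then have "t - b * D \<le> 1"
        using * by simp
      then show False
        using gap q2u by linarith
    qed
    then show ?thesis
      using 1 by (simp add: D_def)
  next
    case 2
    have G: "b * D > 0"
      using b 2 by simp
    have "F \<le> - q\<^sup>2"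
      using markov_form_negative_values[OF T d] 2 by (simp add: F_def)
    then have "U\<^sup>2 * F \<le> U\<^sup>2 * (- q\<^sup>2)"
      by (intro mult_left_mono) auto
    then have *: "q\<^sup>2 * U\<^sup>2 + b\<^sup>2 + D\<^sup>2 \<le> t * (b * D)"
      using form by (simp add: algebra_simps)
    have "q\<^sup>2 * u < b * D"
    proof (rule ccontr)
      assume "\<not> ?thesis"
      then have "t * (b * D) \<le> t * (q\<^sup>2 * u)"
        using t_ge q2u by (intro mult_left_mono) linarith+
      also have "\<dots> \<le> q\<^sup>2 * U\<^sup>2"
        unfolding tq2u by simp
      finally show False
        using * b 2 by (smt (verit) zero_less_power)
    qed
    then show ?thesis
      using 2 by (simp add: D_def)
  next
    case 3
    define b' where "b' = b * u - c * U"
    (* The point (b', c') is the image of (b, c) under the symmetry that interchanges the two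
       linear forms b and b * u - c * U, as the fact dual shows. *)
    define c' where "c' = b * w - c * u"
    have b': "b' = - D" "b' > 0"
      using 3 by (auto simp: b'_def D_def)
    have uwU: "u\<^sup>2 - w * U = 1"
      using inv by (simp add: U(1) algebra_simps power2_eq_square)
    have dual: "b' * u - c' * U = b"
    proof -
      have "b' * u - c' * U = b * (u\<^sup>2 - w * U)"
        by (simp add: b'_def c'_def algebra_simps power2_eq_square)
      then show ?thesis
        using uwU by simp
    qed
    have form': "U\<^sup>2 * F = b\<^sup>2 + b'\<^sup>2 + t * (b * b')"
      using form b' by simp
    have t: "t > 0"
      using t_ge q2u by linarith
    have "U\<^sup>2 * F > 0"
      unfolding form' using t b b'(2) by (intro add_pos_pos) auto
    then have F: "q\<^sup>2 \<le> F"
      using Fpos by (simp add: zero_less_mult_iff)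
    have d': "q dvd l * c' + r * b'"
    proof -
      have "l * c' + r * b' = w * (l * b + r * c) - u * (l * c - r * b) - q * (3 * r * c * u)"
        by (simp add: b'_def c'_def U(1) algebra_simps)
      then show ?thesis
        using d markov_dvd_swap_minus[OF T d] by simp
    qed
    show ?thesis
    proof (cases "b * b' \<le> q\<^sup>2 * u")
      case False
      then show ?thesis
        using b' by (simp add: D_def)
    next
      case le: True
      have "q\<^sup>2 * U\<^sup>2 \<le> U\<^sup>2 * F"
        unfolding mult.commute[of "U\<^sup>2"] using F by (intro mult_right_mono) auto
      also have "\<dots> \<le> b\<^sup>2 + b'\<^sup>2 + t * (q\<^sup>2 * u)"
        unfolding form' using le t by simp
      also note tq2u
      finally have sum: "q\<^sup>2 * (1 + u\<^sup>2) \<le> b\<^sup>2 + b'\<^sup>2"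
        by simp
      (* In units of q: with product at most u and sum of squares at least 1 + u^2,
         one of the two numbers is at most 1. *)
      have "(b * b')\<^sup>2 \<le> (q\<^sup>2 * u)\<^sup>2"
        using le b b'(2) by (intro power_mono) auto
      moreover have "q\<^sup>2 * (q\<^sup>2 * (1 + u\<^sup>2)) \<le> q\<^sup>2 * (b\<^sup>2 + b'\<^sup>2)"
        using sum by (intro mult_left_mono) auto
      ultimately have "(b\<^sup>2 - q\<^sup>2) * (b'\<^sup>2 - q\<^sup>2) \<le> 0"
        by (simp add: algebra_simps power2_eq_square)
      then have "b \<le> q \<or> b' \<le> q"
        using b b'(2) q by (auto simp: mult_le_0_iff)
      then show ?thesis
      proof
        assume bq: "b \<le> q"
        have "c = 0 \<or> q\<^sup>2 * u < b * (b * u - c * U)"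
          using T d b bq b'(2) U w u by (intro small_denominator_bound) (auto simp: b'_def)
        then have c: "c = 0"
          using le by (simp add: b'_def)
        then have "q\<^sup>2 \<le> b\<^sup>2"
          using F by (simp add: F_def)
        then have "b = q"
          using bq b q by (simp add: abs_le_square_iff[symmetric])
        then show ?thesis
          using c u q by (simp add: power2_eq_square abs_mult)
      next
        assume bq: "b' \<le> q"
        have "c' = 0 \<or> q\<^sup>2 * u < b' * (b' * u - c' * U)"
          using T d' b bq b'(2) U w u dual by (intro small_denominator_bound) auto
        then have c': "c' = 0"
          using le dual by (simp add: mult.commute)
        then have bu: "b = b' * u"
          using dual by simp
        have "U\<^sup>2 * F = b'\<^sup>2 * (1 + u\<^sup>2 + t * u)"
          unfolding form' bu by (simp add: algebra_simps power2_eq_square)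
        also have "1 + u\<^sup>2 + t * u = U\<^sup>2"
          using U2 by simp
        finally have "F = b'\<^sup>2"
          using Upos by simp
        then have "q\<^sup>2 \<le> b'\<^sup>2"
          using F by simp
        then have b'q: "b' = q"
          using bq b'(2) q by (simp add: abs_le_square_iff[symmetric])
        moreover have "c = q * w"
          using c' u unfolding c'_def bu b'q by simp
        moreover have "\<bar>c * U - b * u\<bar> = q"
          using b'q b' q by (simp add: D_def)
        ultimately show ?thesis
          using bu by (simp add: power2_eq_square)
      qed
    qed
  qed
qed

section \<open>From integer points to fractions\<close>

lemma Fract_reduced_eqD:
  assumes "Fract a b = Fract c d" "coprime a b" "coprime c d" "b > 0" "d > 0"
  shows "a = c \<and> b = d"
proof -
  have "quotient_of (Fract a b) = (a, b)" "quotient_of (Fract c d) = (c, d)"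
    using assms(2-5) by (simp_all add: quotient_of_Fract)
  then show ?thesis
    using assms(1) by (metis prod.inject)
qed

text \<open>
  Reducing a fraction can only decrease its denominator.  Together with the lower bound for all
  fractions, this computes the quality of a companion without a proof that its representation is reduced.
\<close>

lemma approx_quality_Fract_le:
  assumes "b > 0"
  shows "approx_quality x (Fract a b) \<le> (real_of_int b)\<^sup>2 * \<bar>x - real_of_int a / real_of_int b\<bar>"
proof -
  have "snd (quotient_of (Fract a b)) = b div gcd a b"
    using assms by (simp add: quotient_of_Fract Rat.normalize_def Let_def)
  moreover have "b div gcd a b dvd b"
    by (metis dvd_div_mult_self gcd_dvd2 dvd_triv_left)
  moreover have "0 \<le> b div gcd a b"
    using assms by (simp add: pos_imp_zdiv_nonneg_iff)
  ultimately have "(real_of_int (snd (quotient_of (Fract a b))))\<^sup>2 \<le> (real_of_int b)\<^sup>2"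
    using assms by (intro power_mono) (auto intro: zdvd_imp_le)
  then show ?thesis
    using assms by (auto simp: approx_quality_def of_rat_rat intro: mult_right_mono)
qed

lemma approx_quality_obtain_Fract:
  obtains a b where "r = Fract a b" "b > 0"
    "approx_quality x r = (real_of_int b)\<^sup>2 * \<bar>x - real_of_int a / real_of_int b\<bar>"
proof -
  obtain a b where ab: "quotient_of r = (a, b)"
    by (cases "quotient_of r")
  have "b > 0"
    using ab by (rule quotient_of_denom_pos)
  moreover have "r = Fract a b"
    using quotient_of_div[OF ab] by (simp add: Fract_of_int_quotient)
  ultimately show ?thesis
    using ab by (intro that[of a b]) (auto simp: approx_quality_def of_rat_rat)
qed

text \<open>
  The two equations between the numerators of a rational Markov triple express each numerator,
  modulo its denominator and up to sign, as the quotient of the other two denominators.  The sign can be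
  chosen freely, because interchanging \<open>l\<close> and \<open>r\<close> reverses it.
\<close>

lemma markov_fraction_triple:
  assumes "markov_fraction (Fract p q)" "coprime p q" "q > 0" "s \<in> {1, -1}"
  obtains l r where "markov_triple q l r" "q dvd r + s * p * l"
proof -
  obtain p' q' l r where T: "markov_triple q' l r" and eq: "Fract p q = Fract p' q'"
    and d: "q' dvd r - p' * l \<or> q' dvd r + p' * l"
  proof -
    obtain p1 p2 p3 q1 q2 q3 where T: "markov_triple q1 q2 q3"
      and x: "Fract p q \<in> {Fract p1 q1, Fract p2 q2, Fract p3 q3}"
      and e: "p2 * q1 - p1 * q2 = q3" "p3 * q2 - p2 * q3 = q1"
      using assms(1) unfolding markov_fraction_def rational_markov_triple_def by blast
    have "q3 + p1 * q2 = q1 * p2" "q3 - p2 * q1 = q2 * (- p1)" "q1 - p3 * q2 = q3 * (- p2)"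
      using e by (simp_all add: algebra_simps)
    then have "q1 dvd q3 + p1 * q2" "q2 dvd q3 - p2 * q1" "q3 dvd q1 - p3 * q2"
      by (metis dvd_triv_left)+
    moreover have "markov_triple q2 q1 q3" "markov_triple q3 q2 q1"
      using T by (auto simp: markov_triple_def algebra_simps)
    ultimately show ?thesis
      using x T that by blast
  qed
  have "coprime p' q'"
  proof (rule coprimeI)
    fix d' assume d': "d' dvd p'" "d' dvd q'"
    have "d' dvd r - p' * l \<or> d' dvd r + p' * l"
      using d d'(2) by (meson dvd_trans)
    then have "d' dvd r"
      using d'(1) by (auto simp: dvd_diff_left_iff dvd_add_left_iff)
    then show "is_unit d'"
      using d' markov_triple_coprime[OF markov_triple_swap23[OF T]]
      by (metis coprime_common_divisor)
  qed
  moreover have "q' > 0"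
    using T by (simp add: markov_triple_def)
  ultimately have pq: "p' = p" "q' = q"
    using Fract_reduced_eqD[OF eq] assms by auto
  have swap: "q dvd l + e * r" if "q dvd r - e * l" for e
  proof -
    have "r * (l + e * r) = (l\<^sup>2 + r\<^sup>2) * e + l * (r - e * l)"
      by (simp add: algebra_simps power2_eq_square)
    then have "q dvd r * (l + e * r)"
      using that markov_triple_dvd_sum_squares[OF T] pq by simp
    then show ?thesis
      using markov_triple_coprime[OF markov_triple_swap23[OF T]] pq
      by (simp add: coprime_dvd_mult_right_iff)
  qed
  consider "q dvd r + s * p * l" | "q dvd r - s * p * l"
    using d assms(4) pq by auto
  then show thesis
  proof cases
    case 1
    with that T pq show ?thesis
      by blast
  next
    case 2
    then have "q dvd l + s * p * r"
      by (intro swap) simp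
    with that markov_triple_swap23[OF T] pq show ?thesis
      by blast
  qed
qed

lemma companion_seq_Suc:
  assumes "q > 0"
  shows "companion_seq s p q (Suc n) =
    Fract (p * useq q (Suc n) + s * useq q n) (q * useq q (Suc n))"
proof -
  have "useq q (Suc n) > 0"
    using useq_growth[OF assms] by blast
  then show ?thesis
    using assms
    by (simp add: companion_seq_def Fract_of_int_quotient add_divide_distrib del: useq.simps)
qed

text \<open>
  With \<open>c = s (a q - b p)\<close> the right-hand side contains the product studied above; the factor \<open>s\<close>
  treats left and right companions alike.
\<close>

lemma companion_scaled_distance:
  fixes s p q a b u U :: int
  assumes "s \<in> {1, -1}" "q > 0" "b > 0" "U > 0"
  shows "(real_of_int b)\<^sup>2 * \<bar>real_of_int (p * U + s * u) / real_of_int (q * U) - a / b\<bar> =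
    real_of_int (b * \<bar>s * (a * q - b * p) * U - b * u\<bar>) / real_of_int (q * U)"
proof -
  have "real_of_int (p * U + s * u) / real_of_int (q * U) - a / b =
      real_of_int ((p * U + s * u) * b - a * (q * U)) / real_of_int (q * U * b)"
    using assms by (simp add: field_simps)
  also have "(p * U + s * u) * b - a * (q * U) = - s * (s * (a * q - b * p) * U - b * u)"
    using assms(1) by (auto simp: algebra_simps)
  finally have "\<bar>real_of_int (p * U + s * u) / real_of_int (q * U) - a / b\<bar> =
      real_of_int \<bar>s * (a * q - b * p) * U - b * u\<bar> / real_of_int (q * U * b)"
    using assms by (auto simp: abs_mult)
  then show ?thesis
    using assms by (simp add: power2_eq_square)
qed

theorem theorem3p14:
  fixes p q s :: int and k :: nat
  assumes "markov_fraction (Fract p q)" and "coprime p q" and "q > 0"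
    and "s \<in> {1, -1}" and "k \<ge> 2"
  defines "x \<equiv> real_of_rat (companion_seq s p q k)"
  shows "best_approximants x = {Fract p q, companion_seq s p q (k - 1)}
    \<and> approx_const x = (real_of_int q)\<^sup>2 * \<bar>x - real_of_rat (Fract p q)\<bar>
    \<and> approx_const x =
        (real_of_int (q * useq q (k - 1)))\<^sup>2 * \<bar>x - real_of_rat (companion_seq s p q (k - 1))\<bar>
    \<and> (\<forall>a b :: int. b > 0
         \<and> Fract a b \<notin> {Fract p q, companion_seq s p q (k - 1), companion_seq s p q k} \<longrightarrow>
         approx_const x < (real_of_int b)\<^sup>2 * \<bar>x - real_of_int a / real_of_int b\<bar>)
    \<and> approx_const x = real_of_int q * (real_of_int (useq q (k - 1)) / real_of_int (useq q k))
    \<and> approx_const x \<ge> 1 / 3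
    \<and> (approx_const x = 1 / 3 \<longleftrightarrow> k = 2)"
proof -
  obtain j where k: "k = Suc (Suc j)"
    using \<open>k \<ge> 2\<close> by (metis add_2_eq_Suc le_Suc_ex)
  define u U w where uUw: "u = useq q (k - 1)" "U = useq q k" "w = useq q j"
  have U: "U = 3 * q * u - w" "2 * q * u \<le> U" "U > 0" and u: "u > 0"
    and w: "0 \<le> w" "2 * q * w \<le> u"
    using useq_growth[OF \<open>q > 0\<close>, of j] useq_growth[OF \<open>q > 0\<close>, of "Suc j"]
    by (simp_all add: uUw k)
  have inv: "u\<^sup>2 + w\<^sup>2 - 3 * q * u * w = 1"
    using useq_invariant[of q j] by (simp add: uUw k)
  have uwU: "u * u - w * U = 1"
    using inv by (simp add: U(1) algebra_simps power2_eq_square)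
  have gamma_k: "companion_seq s p q k = Fract (p * U + s * u) (q * U)"
    using companion_seq_Suc[OF \<open>q > 0\<close>, of s p "Suc j"] by (simp add: uUw k del: useq.simps)
  have gamma: "companion_seq s p q (k - 1) = Fract (p * u + s * w) (q * u)"
    using companion_seq_Suc[OF \<open>q > 0\<close>, of s p j] by (simp add: uUw k del: useq.simps)
  have x: "x = real_of_int (p * U + s * u) / real_of_int (q * U)"
    using \<open>q > 0\<close> U(3) unfolding x_def gamma_k by (subst of_rat_rat) auto
  define Q where "Q a b = (real_of_int b)\<^sup>2 * \<bar>x - real_of_int a / real_of_int b\<bar>" for a b :: int
  define M where "M = real_of_int (q\<^sup>2 * u) / real_of_int (q * U)"
  have Q: "Q a b = real_of_int (b * \<bar>s * (a * q - b * p) * U - b * u\<bar>) / real_of_int (q * U)"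
    if "b > 0" for a b
    unfolding Q_def x using companion_scaled_distance assms that U(3) by blast
  have real_inj: "Fract a b = companion_seq s p q k \<longleftrightarrow> real_of_int a / real_of_int b = x"
    if "b > 0" for a b
    using that unfolding x_def by (metis of_rat_rat of_rat_eq_iff less_irrefl)

  obtain l r where T: "markov_triple q l r" and lr: "q dvd r + s * p * l"
    using markov_fraction_triple assms by blast
  have bound: "M < Q a b \<or> Q a b = M \<and> Fract a b \<in> {Fract p q, companion_seq s p q (k - 1)}"
    if b: "b > 0" and ne: "Fract a b \<noteq> companion_seq s p q k" for a b
  proof -
    define c where "c = s * (a * q - b * p)"
    have "l * c - r * b = q * (s * l * a) - b * (r + s * p * l)"
      by (simp add: c_def algebra_simps)
    then have d: "q dvd l * c - r * b"
      using lr by simp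
    have "Q a b \<noteq> 0"
      using real_inj[OF b, of a] ne b by (auto simp: Q_def)
    moreover have Qc: "Q a b = real_of_int (b * \<bar>c * U - b * u\<bar>) / real_of_int (q * U)"
      unfolding Q[OF b] c_def ..
    ultimately have nz: "c * U - b * u \<noteq> 0"
      by (metis abs_zero div_0 mult_zero_right of_int_0)
    have qU: "real_of_int (q * U) > 0"
      using \<open>q > 0\<close> U(3) by simp
    from companion_product_bound[OF T d b U(1,2) w u inv nz]
    consider "q\<^sup>2 * u < b * \<bar>c * U - b * u\<bar>"
      | "q\<^sup>2 * u = b * \<bar>c * U - b * u\<bar>" "b = q" "c = 0"
      | "q\<^sup>2 * u = b * \<bar>c * U - b * u\<bar>" "b = q * u" "c = q * w"
      by blast
    then show ?thesis
    proof cases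
      case 1
      then show ?thesis
        unfolding M_def Qc using qU by (intro disjI1 divide_strict_right_mono) linarith+
    next
      case 2
      then have "a = p"
        using assms by (auto simp: c_def)
      moreover have "Q a b = M"
        unfolding M_def Qc 2(1) ..
      ultimately show ?thesis
        using 2(2) by simp
    next
      case 3
      have "s * c = a * q - b * p"
        using assms by (auto simp: c_def)
      then have "q * a = q * (p * u + s * w)"
        unfolding 3(2,3) by (simp add: algebra_simps)
      then have "a = p * u + s * w"
        using \<open>q > 0\<close> by simp
      moreover have "Q a b = M"
        unfolding M_def Qc 3(1) ..
      ultimately show ?thesis
        unfolding gamma using 3(2) by simp
    qed
  qed

  have qu: "q * u > 0"
    using \<open>q > 0\<close> u by simp
  have Q_p: "Q p q = M"
    using Q[OF \<open>q > 0\<close>, of p] \<open>q > 0\<close> u by (simp add: M_def power2_eq_square abs_mult)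
  have Q_gamma: "Q (p * u + s * w) (q * u) = M"
  proof -
    have "s * ((p * u + s * w) * q - q * u * p) * U - q * u * u = - q * (u * u - w * U)"
      using assms by (auto simp: algebra_simps)
    then have "q * u * \<bar>s * ((p * u + s * w) * q - q * u * p) * U - q * u * u\<bar> = q\<^sup>2 * u"
      unfolding uwU using \<open>q > 0\<close> by (simp add: power2_eq_square)
    then show ?thesis
      unfolding Q[OF qu] M_def by (simp only:)
  qed
  have M_pos: "M > 0"
    using \<open>q > 0\<close> u U(3) by (simp add: M_def)
  have "Fract p q \<noteq> companion_seq s p q k" "companion_seq s p q (k - 1) \<noteq> companion_seq s p q k"
    using real_inj[OF \<open>q > 0\<close>] real_inj[OF qu] Q_p Q_gamma M_pos unfolding gamma Q_def by auto
  then have ne: "real_of_rat (Fract p q) \<noteq> x" "real_of_rat (companion_seq s p q (k - 1)) \<noteq> x"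
    by (simp_all add: x_def)

  have ge: "M \<le> approx_quality x r" if "real_of_rat r \<noteq> x" for r
  proof -
    obtain a b where "r = Fract a b" "b > 0" "approx_quality x r = Q a b"
      using approx_quality_obtain_Fract unfolding Q_def by metis
    then show ?thesis
      using bound[of b a] that by (auto simp: x_def)
  qed
  have attained: "approx_quality x r = M" if r: "r = Fract p q \<or> r = companion_seq s p q (k - 1)" for r
  proof (rule antisym)
    show "approx_quality x r \<le> M"
      using r approx_quality_Fract_le[OF \<open>q > 0\<close>, of x p] approx_quality_Fract_le[OF qu, of x]
        Q_p Q_gamma unfolding gamma Q_def by metis
    show "M \<le> approx_quality x r"
      using r ne by (intro ge) auto
  qed
  have const: "approx_const x = M"
    unfolding approx_const_def
  proof (rule cInf_eq_minimum)
    show "M \<in> approx_quality x ` {r. real_of_rat r \<noteq> x}"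
      using attained[of "Fract p q"] ne by force
  qed (use ge in auto)
  have "best_approximants x = {Fract p q, companion_seq s p q (k - 1)}"
  proof (intro equalityI subsetI)
    fix r assume "r \<in> best_approximants x"
    then have r: "real_of_rat r \<noteq> x" "approx_quality x r = M"
      by (auto simp: best_approximants_def const)
    obtain a b where "r = Fract a b" "b > 0" "approx_quality x r = Q a b"
      using approx_quality_obtain_Fract unfolding Q_def by metis
    then show "r \<in> {Fract p q, companion_seq s p q (k - 1)}"
      using bound[of b a] r by (auto simp: x_def)
  next
    fix r assume "r \<in> {Fract p q, companion_seq s p q (k - 1)}"
    then show "r \<in> best_approximants x"
      using attained[of r] ne by (auto simp: best_approximants_def const)
  qed
  moreover have "approx_const x = (real_of_int q)\<^sup>2 * \<bar>x - real_of_rat (Fract p q)\<bar>"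
    using Q_p \<open>q > 0\<close> by (simp add: const Q_def of_rat_rat)
  moreover have "approx_const x =
      (real_of_int (q * useq q (k - 1)))\<^sup>2 * \<bar>x - real_of_rat (companion_seq s p q (k - 1))\<bar>"
    using Q_gamma qu unfolding const gamma Q_def uUw(1)[symmetric] by (subst of_rat_rat) auto
  moreover have "\<forall>a b. b > 0
      \<and> Fract a b \<notin> {Fract p q, companion_seq s p q (k - 1), companion_seq s p q k} \<longrightarrow>
      approx_const x < (real_of_int b)\<^sup>2 * \<bar>x - real_of_int a / real_of_int b\<bar>"
    using bound unfolding const Q_def by blast
  moreover have const_eq: "approx_const x =
      real_of_int q * (real_of_int (useq q (k - 1)) / real_of_int (useq q k))"
    unfolding const M_def uUw(1,2)[symmetric] using \<open>q > 0\<close> by (simp add: power2_eq_square)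
  moreover have "approx_const x \<ge> 1 / 3" "approx_const x = 1 / 3 \<longleftrightarrow> w = 0"
  proof -
    have "real_of_int q * real_of_int u = (real_of_int U + real_of_int w) / 3"
      using U(1) by simp
    then have "approx_const x = 1 / 3 + real_of_int w / (3 * real_of_int U)"
      using const_eq U(3) unfolding uUw(1,2)[symmetric] by (simp add: add_divide_distrib)
    then show "approx_const x \<ge> 1 / 3" "approx_const x = 1 / 3 \<longleftrightarrow> w = 0"
      using U(3) w(1) by auto
  qed
  moreover have "w = 0 \<longleftrightarrow> k = 2"
    using useq_growth[OF \<open>q > 0\<close>, of "j - 1"] by (cases j) (auto simp: uUw k)
  ultimately show ?thesis
    by blast
qed

end
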